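(* Let $m_1=m_2=m_3>0$. The bifurcation points between equilateral $LRE$ and isosceles $LRE$ are exactly the two points $\sigma_1=\sigma_2=\sigma_3=\sigma_c$ and $\sigma_1=\sigma_2=\sigma_3=\pi-\sigma_c$, where $\sigma_c=\tfrac12\arccos(-4/5)=1.249\ldots$.
   Context: Three point masses $m_1,m_2,m_3>0$ move on the unit sphere $\mathbb{S}^2$ under the cotangent potential. A shape is a triple $(\sigma_1,\sigma_2,\sigma_3)$, where $\sigma_k$ is the angle of the minor arc between masses $i$ and $j$, $\{i,j,k\}=\{1,2,3\}$. Let $U=(0,\pi)^3$ and $U_{\mathrm{phys}}=\{(\sigma_1,\sigma_2,\sigma_3)\in U:\ \sigma_k\le\sigma_i+\sigma_j \text{ for all } \{i,j,k\}=\{1,2,3\},\ \sigma_1+\sigma_2+\sigma_3\le 2\pi\}$. For $\{i,j,k\}=\{1,2,3\}$ set $$\lambda_i=\frac{(m_j+m_k)\sin^3\sigma_i-m_j\cos\sigma_k\sin^3\sigma_j-m_k\cos\sigma_j\sin^3\sigma_k}{\sin^3\sigma_i}.$$ A shape in $U_{\mathrm{phys}}$ forms a Lagrange relative equilibrium ($LRE$) iff $\lambda_1=\lambda_2=\lambda_3$. A continuation of $LRE$ is a regular $C^1$ curve of such shapes. A bifurcation point between equilateral and isosceles $LRE$ is a point of $U_{\mathrm{phys}}$ at which a continuation consisting of equilateral shapes ($\sigma_1=\sigma_2=\sigma_3$) intersects a continuation consisting, apart from the intersection point, of isosceles non-equilateral shapes (exactly two of the $\sigma$'s equal). *)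

theory Defs
  imports "HOL-Analysis.Analysis"
begin

text \<open>
  A shape is a vector \<open>s :: real ^ 3\<close>; \<open>s $ k\<close> is the length of the minor arc joining the
  two masses other than the \<open>k\<close>-th.
\<close>

definition U :: "(real ^ 3) set" where
  "U = {s. \<forall>k. 0 < s $ k \<and> s $ k < pi}"

definition U_phys :: "(real ^ 3) set" where
  "U_phys = {s \<in> U. (\<forall>i j k. {i, j, k} = UNIV \<longrightarrow> s $ k \<le> s $ i + s $ j)
                   \<and> s $ 1 + s $ 2 + s $ 3 \<le> 2 * pi}"

text \<open>
  Arithmetic in the index type \<open>3\<close> is modulo 3, so \<open>i\<close>, \<open>i + 1\<close>, \<open>i + 2\<close> are the three indices.
  The formula is symmetric in \<open>j\<close> and \<open>k\<close>, so it does not matter which of the two is \<open>i + 1\<close>.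
\<close>

definition lam :: "real ^ 3 \<Rightarrow> real ^ 3 \<Rightarrow> 3 \<Rightarrow> real" where
  "lam m s i = (let j = i + 1; k = i + 2 in
     ((m $ j + m $ k) * sin (s $ i) ^ 3
        - m $ j * cos (s $ k) * sin (s $ j) ^ 3
        - m $ k * cos (s $ j) * sin (s $ k) ^ 3) / sin (s $ i) ^ 3)"

definition LRE :: "real ^ 3 \<Rightarrow> (real ^ 3) set" where
  "LRE m = {s \<in> U_phys. lam m s 1 = lam m s 2 \<and> lam m s 2 = lam m s 3}"

definition equilateral :: "real ^ 3 \<Rightarrow> bool" where
  "equilateral s \<longleftrightarrow> s $ 1 = s $ 2 \<and> s $ 2 = s $ 3"

definition isosceles_nonequilateral :: "real ^ 3 \<Rightarrow> bool" where
  "isosceles_nonequilateral s \<longleftrightarrow>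
     (s $ 1 = s $ 2 \<or> s $ 2 = s $ 3 \<or> s $ 1 = s $ 3) \<and> \<not> equilateral s"

definition LRE_continuation :: "real ^ 3 \<Rightarrow> (real \<Rightarrow> real ^ 3) \<Rightarrow> real \<Rightarrow> real \<Rightarrow> bool" where
  "LRE_continuation m \<gamma> a b \<longleftrightarrow>
     a < b \<and> \<gamma> C1_differentiable_on {a<..<b}
     \<and> (\<forall>t \<in> {a<..<b}. vector_derivative \<gamma> (at t) \<noteq> 0)
     \<and> \<gamma> ` {a<..<b} \<subseteq> LRE m"

definition equilateral_isosceles_bifurcation_point :: "real ^ 3 \<Rightarrow> real ^ 3 \<Rightarrow> bool" where
  "equilateral_isosceles_bifurcation_point m p \<longleftrightarrow>
     p \<in> U_phys
     \<and> (\<exists>\<gamma> a b. LRE_continuation m \<gamma> a b \<and> p \<in> \<gamma> ` {a<..<b}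
          \<and> (\<forall>s \<in> \<gamma> ` {a<..<b}. equilateral s))
     \<and> (\<exists>\<delta> c d. LRE_continuation m \<delta> c d \<and> p \<in> \<delta> ` {c<..<d}
          \<and> (\<forall>s \<in> \<delta> ` {c<..<d} - {p}. isosceles_nonequilateral s))"

definition sigma_c :: real where
  "sigma_c = 1 / 2 * arccos (- 4 / 5)"

end

theory Submission
  imports Defs
begin

text \<open>
  For equal masses every equilateral shape satisfies \<open>\<lambda>\<^sub>1 = \<lambda>\<^sub>2 = \<lambda>\<^sub>3\<close>, so the question is where
  isosceles solutions accumulate on the diagonal.  For an isosceles shape with repeated angle \<open>x\<close>
  and odd angle \<open>y\<close>, put \<open>r = sin y / sin x\<close>.  The three equations collapse to
  \<open>cos y * r ^ 3 = cos x * (2 - r ^ 6)\<close> (\<open>balanced_iff\<close>).  Squaring and eliminating \<open>cos y\<close> by means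
  of \<open>sin y = r * sin x\<close> makes a factor \<open>1 - r\<^sup>2\<close> appear on both sides; this factor is the
  equilateral family.  Dividing it out leaves the isosceles family
  \<open>(cos x)\<^sup>2 * D r = r ^ 6\<close> with \<open>D r = 4 + 4 r\<^sup>2 + 4 r ^ 4 - r ^ 8 - r ^ 10\<close>
  (\<open>balanced_imp_cos_square\<close>).  It meets the equilateral family at \<open>r = 1\<close>, where \<open>D 1 = 10\<close>,
  that is, where \<open>(cos x)\<^sup>2 = 1 / 10\<close>.  As \<open>cos (2 x) = 2 (cos x)\<^sup>2 - 1\<close>, this says
  \<open>cos (2 x) = - 4 / 5\<close>, whose solutions in \<open>(0, \<pi>)\<close> are \<open>\<sigma>\<^sub>c\<close> and \<open>\<pi> - \<sigma>\<^sub>c\<close>.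

  At a bifurcation point the regular isosceles curve takes values different from the point itself at
  arbitrarily near parameters, so the equation of the isosceles family passes to the limit
  (\<open>bifurcation_point_imp_cos\<close>).  Conversely, the equation can be solved for \<open>x\<close> and \<open>y\<close> as explicit
  functions of \<open>r\<close>, which gives the isosceles continuation through each of the two points
  (\<open>isosceles_LRE_curve\<close>).
\<close>

section \<open>Isosceles shapes of equal masses\<close>

lemma lam_equal_masses:
  fixes m s :: "real ^ 3"
  assumes "m $ 1 = M" "m $ 2 = M" "m $ 3 = M"
  assumes "s \<in> U"
  shows "lam m s 1 = M * (2 - (cos (s$3) * sin (s$2) ^ 3 + cos (s$2) * sin (s$3) ^ 3) / sin (s$1) ^ 3)"
    and "lam m s 2 = M * (2 - (cos (s$1) * sin (s$3) ^ 3 + cos (s$3) * sin (s$1) ^ 3) / sin (s$2) ^ 3)"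
    and "lam m s 3 = M * (2 - (cos (s$2) * sin (s$1) ^ 3 + cos (s$1) * sin (s$2) ^ 3) / sin (s$3) ^ 3)"
proof -
  have idx: "(1::3) + 1 = 2" "(1::3) + 2 = 3" "(2::3) + 1 = 3" "(2::3) + 2 = 1" "(3::3) + 1 = 1" "(3::3) + 2 = 2"
    by simp_all
  have pos: "sin (s $ i) \<noteq> 0" for i
    using assms(4) sin_gt_zero[of "s $ i"] by (force simp: U_def)
  show "lam m s 1 = M * (2 - (cos (s$3) * sin (s$2) ^ 3 + cos (s$2) * sin (s$3) ^ 3) / sin (s$1) ^ 3)"
    and "lam m s 2 = M * (2 - (cos (s$1) * sin (s$3) ^ 3 + cos (s$3) * sin (s$1) ^ 3) / sin (s$2) ^ 3)"
    and "lam m s 3 = M * (2 - (cos (s$2) * sin (s$1) ^ 3 + cos (s$1) * sin (s$2) ^ 3) / sin (s$3) ^ 3)"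
    using pos[of 1] pos[of 2] pos[of 3]
    by (simp_all only: lam_def Let_def idx assms) (simp_all add: field_simps)
qed

text \<open>
  The condition for an isosceles \<open>LRE\<close> with repeated angle \<open>x\<close> and odd angle \<open>y\<close>, written in terms of
  the ratio of sines because that ratio later serves as the curve parameter.
\<close>
definition balanced :: "real \<Rightarrow> real \<Rightarrow> bool" where
  "balanced x y \<longleftrightarrow> cos y * (sin y / sin x) ^ 3 = cos x * (2 - (sin y / sin x) ^ 6)"

lemma balanced_iff:
  assumes "sin x \<noteq> 0" "sin y \<noteq> 0" "M \<noteq> 0"
  shows "M * (2 - (cos y * sin x ^ 3 + cos x * sin y ^ 3) / sin x ^ 3)
          = M * (2 - (cos x * sin x ^ 3 + cos x * sin x ^ 3) / sin y ^ 3) \<longleftrightarrow> balanced x y"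
proof -
  define r where "r = sin y / sin x"
  have r: "r \<noteq> 0" and sy: "sin y = r * sin x" using assms by (auto simp: r_def)
  have "(cos y * sin x ^ 3 + cos x * sin y ^ 3) / sin x ^ 3 = cos y + cos x * r ^ 3"
    using assms by (simp add: sy field_simps)
  moreover have "(cos x * sin x ^ 3 + cos x * sin x ^ 3) / sin y ^ 3 = 2 * cos x / r ^ 3"
    using assms r by (simp add: sy power_mult_distrib)
  moreover have "cos y + cos x * r ^ 3 = 2 * cos x / r ^ 3 \<longleftrightarrow> (cos y + cos x * r ^ 3) * r ^ 3 = 2 * cos x"
    using r by (simp add: eq_divide_eq)
  moreover have "(cos y + cos x * r ^ 3) * r ^ 3 = cos y * r ^ 3 + cos x * r ^ 6"
    by (simp add: algebra_simps flip: power_add)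
  ultimately show ?thesis
    using assms(3) by (simp add: balanced_def flip: r_def) (auto simp: algebra_simps)
qed

text \<open>
  Two of the three values of \<open>\<lambda>\<close> agree by the reflection symmetry of the triangle, so that a single
  equation remains, the same one for each of the three positions of the odd angle.
\<close>
lemma lam_isosceles_iff_balanced:
  fixes m s :: "real ^ 3"
  assumes "m $ 1 = M" "m $ 2 = M" "m $ 3 = M" "M \<noteq> 0" and s: "s \<in> U"
  shows "s $ 1 = s $ 2 \<Longrightarrow> lam m s 1 = lam m s 2 \<and> lam m s 2 = lam m s 3 \<longleftrightarrow> balanced (s $ 1) (s $ 3)"
    and "s $ 2 = s $ 3 \<Longrightarrow> lam m s 1 = lam m s 2 \<and> lam m s 2 = lam m s 3 \<longleftrightarrow> balanced (s $ 2) (s $ 1)"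
    and "s $ 1 = s $ 3 \<Longrightarrow> lam m s 1 = lam m s 2 \<and> lam m s 2 = lam m s 3 \<longleftrightarrow> balanced (s $ 1) (s $ 2)"
proof -
  have pos: "sin (s $ i) \<noteq> 0" for i
    using s sin_gt_zero[of "s $ i"] by (force simp: U_def)
  note iff = balanced_iff[OF pos pos assms(4), symmetric]
  show "s $ 1 = s $ 2 \<Longrightarrow> lam m s 1 = lam m s 2 \<and> lam m s 2 = lam m s 3 \<longleftrightarrow> balanced (s $ 1) (s $ 3)"
    unfolding lam_equal_masses[OF assms(1-3) s] iff[of 1 3] by (auto simp: add.commute)
  show "s $ 2 = s $ 3 \<Longrightarrow> lam m s 1 = lam m s 2 \<and> lam m s 2 = lam m s 3 \<longleftrightarrow> balanced (s $ 2) (s $ 1)"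
    unfolding lam_equal_masses[OF assms(1-3) s] iff[of 2 1] by (auto simp: add.commute)
  show "s $ 1 = s $ 3 \<Longrightarrow> lam m s 1 = lam m s 2 \<and> lam m s 2 = lam m s 3 \<longleftrightarrow> balanced (s $ 1) (s $ 2)"
    unfolding lam_equal_masses[OF assms(1-3) s] iff[of 1 2] by (auto simp: add.commute)
qed

lemma isosceles_LRE_imp_balanced:
  fixes m s :: "real ^ 3"
  assumes "m $ 1 = M" "m $ 2 = M" "m $ 3 = M" "M \<noteq> 0"
  assumes "s \<in> LRE m" "isosceles_nonequilateral s"
  obtains i k where "s $ i \<noteq> s $ k" "balanced (s $ i) (s $ k)"
proof -
  have "s \<in> U" and lam: "lam m s 1 = lam m s 2 \<and> lam m s 2 = lam m s 3"
    using assms(5) by (auto simp: LRE_def U_phys_def)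
  note iff = lam_isosceles_iff_balanced[OF assms(1-4) this(1)]
  consider "s $ 1 = s $ 2" "s $ 1 \<noteq> s $ 3" | "s $ 2 = s $ 3" "s $ 2 \<noteq> s $ 1" | "s $ 1 = s $ 3" "s $ 1 \<noteq> s $ 2"
    using assms(6) by (auto simp: isosceles_nonequilateral_def equilateral_def)
  then show ?thesis
    using lam iff that by cases metis+
qed

section \<open>Splitting off the equilateral family\<close>

text \<open>
  The polynomial \<open>D\<close> that remains after dividing \<open>(2 - r ^ 6)\<^sup>2 - r ^ 8\<close> by \<open>1 - r\<^sup>2\<close>.
\<close>
definition branch_denom :: "real \<Rightarrow> real" where
  "branch_denom r = 4 + 4 * r ^ 2 + 4 * r ^ 4 - r ^ 8 - r ^ 10"

lemma branch_denom_factor: "(2 - r ^ 6)\<^sup>2 - r ^ 8 = (1 - r\<^sup>2) * branch_denom r"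
  by (simp add: branch_denom_def power2_diff algebra_simps)

text \<open>
  The two differences are the numerators of \<open>(sin x)\<^sup>2\<close> and \<open>(sin y)\<^sup>2\<close> along the isosceles family.
  Their quotient is exactly \<open>r\<^sup>2\<close>, and for \<open>r > 0\<close> both are positive as long as \<open>r ^ 6 < 4\<close>.
\<close>
lemma branch_denom_diff:
  "branch_denom r - r ^ 6 = (1 + r ^ 2 + r ^ 4) * (4 - r ^ 6)"
  "branch_denom r - (2 - r ^ 6)\<^sup>2 = r\<^sup>2 * ((1 + r ^ 2 + r ^ 4) * (4 - r ^ 6))"
  by (simp_all add: branch_denom_def power2_diff algebra_simps)

text \<open>
  Squaring the balance equation and replacing \<open>(cos y)\<^sup>2\<close> by \<open>1 - r\<^sup>2 (sin x)\<^sup>2\<close> gives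
  \<open>(1 - r\<^sup>2) * ((cos x)\<^sup>2 * D r - r ^ 6) = 0\<close>.  The first factor vanishes only for \<open>r = 1\<close>, and then
  the balance equation itself reads \<open>cos y = cos x\<close>, which excludes the supplementary solution
  \<open>y = \<pi> - x\<close>.
\<close>
lemma balanced_imp_cos_square:
  assumes x: "0 < x" "x < pi" and y: "0 < y" "y < pi" and ne: "x \<noteq> y" and bal: "balanced x y"
  shows "cos x ^ 2 * branch_denom (sin y / sin x) = (sin y / sin x) ^ 6"
proof -
  define r where "r = sin y / sin x"
  have sx: "sin x > 0" and sy: "sin y > 0" using x y by (auto intro: sin_gt_zero)
  have r: "r > 0" and syr: "sin y = r * sin x" using sx sy by (auto simp: r_def)
  have b: "cos y * r ^ 3 = cos x * (2 - r ^ 6)" using bal by (simp add: balanced_def r_def)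
  have "r \<noteq> 1"
  proof
    assume "r = 1"
    then have "cos y = cos x" using b by simp
    then show False using x y ne by (metis arccos_cos less_imp_le)
  qed
  then have r2: "r ^ 2 \<noteq> 1" using r by (simp add: power2_eq_1_iff)
  have cy: "cos y ^ 2 = 1 - r ^ 2 * (1 - cos x ^ 2)"
    using sin_cos_squared_add[of y] by (simp add: syr power_mult_distrib sin_squared_eq)
  have "cos y ^ 2 * r ^ 6 = cos x ^ 2 * (2 - r ^ 6) ^ 2"
    using arg_cong[OF b, of "\<lambda>z. z ^ 2"] by (simp add: power_mult_distrib)
  then have "cos x ^ 2 * ((2 - r ^ 6) ^ 2 - r ^ 8) = (1 - r ^ 2) * r ^ 6"
    unfolding cy by (simp add: algebra_simps)
  then have "(1 - r ^ 2) * (cos x ^ 2 * branch_denom r) = (1 - r ^ 2) * r ^ 6"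
    by (simp add: mult.left_commute flip: branch_denom_factor)
  then show ?thesis using r2 by (simp add: r_def)
qed

section \<open>The critical angle\<close>

lemma sigma_c_basic: "0 < sigma_c" "sigma_c < pi / 2" "cos sigma_c ^ 2 = 1 / 10"
proof -
  have b: "0 < arccos (- 4 / 5)" "arccos (- 4 / 5) < pi"
    using arccos_lt_bounded[of "- 4 / 5"] by auto
  then show "0 < sigma_c" "sigma_c < pi / 2" by (auto simp: sigma_c_def)
  have "cos (2 * sigma_c) = - 4 / 5" by (simp add: sigma_c_def)
  then show "cos sigma_c ^ 2 = 1 / 10" unfolding cos_double_cos by simp
qed

lemma cos_square_tenth_iff:
  assumes "0 < x" "x < pi"
  shows "cos x ^ 2 = 1 / 10 \<longleftrightarrow> x = sigma_c \<or> x = pi - sigma_c"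
proof
  assume "cos x ^ 2 = 1 / 10"
  then have "cos x = cos sigma_c \<or> cos x = - cos sigma_c"
    using sigma_c_basic(3) by (metis power2_eq_iff)
  then have "cos x = cos sigma_c \<or> cos x = cos (pi - sigma_c)" by simp
  then show "x = sigma_c \<or> x = pi - sigma_c"
    using assms sigma_c_basic cos_inj_pi[of x sigma_c] cos_inj_pi[of x "pi - sigma_c"] by auto
qed (use sigma_c_basic in auto)

text \<open>
  An equilateral shape with angle \<open>x\<close> has perimeter \<open>3 x\<close>, so this puts the two candidate points
  strictly inside the region of physical shapes.
\<close>
lemma cos_square_tenth_imp_less:
  assumes "0 < x" "x < pi" "cos x ^ 2 = 1 / 10"
  shows "x < 2 * pi / 3"
proof -
  have "\<bar>cos x\<bar> < 1 / 2"
    by (rule power2_less_imp_less) (simp_all add: assms(3) power_divide)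
  then have "cos (2 * pi / 3) < cos x" by (simp add: cos_120)
  then show "x < 2 * pi / 3"
    using assms cos_mono_less_eq[of "2*pi/3" x] by auto
qed

text \<open>
  The lower bound \<open>1.249\<close> is off by less than \<open>5 * 10 ^ -5\<close>; an error term of order \<open>x ^ 12\<close> is far
  below that for \<open>x\<close> near \<open>1.25\<close>.
\<close>
lemma cos_Maclaurin_12:
  "\<bar>cos x - (1 - x\<^sup>2 / 2 + x ^ 4 / 24 - x ^ 6 / 720 + x ^ 8 / 40320 - x ^ 10 / 3628800)\<bar>
     \<le> \<bar>x\<bar> ^ 12 / 479001600" for x :: real
proof -
  obtain t where t: "cos x = (\<Sum>m<12. cos_coeff m * x ^ m) + cos (t + 1/2 * real (12::nat) * pi) / fact 12 * x ^ 12"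
    using Maclaurin_cos_expansion[of x 12] by auto
  have "(\<Sum>m<12. cos_coeff m * x ^ m) = 1 - x\<^sup>2 / 2 + x ^ 4 / 24 - x ^ 6 / 720 + x ^ 8 / 40320 - x ^ 10 / 3628800"
    by (simp add: lessThan_nat_numeral cos_coeff_def fact_numeral)
  moreover have "\<bar>cos (t + 1/2 * real (12::nat) * pi) / fact 12 * x ^ 12\<bar> \<le> \<bar>x\<bar> ^ 12 / 479001600"
    using mult_right_mono[OF abs_cos_le_one, of "\<bar>x\<bar>^12"]
    by (simp add: abs_mult power_abs fact_numeral)
  ultimately show ?thesis unfolding t by simp
qed

lemma sigma_c_numeric: "1.249 \<le> sigma_c" "sigma_c < 1.250"
proof -
  have c: "cos sigma_c > 0" using sigma_c_basic by (intro cos_gt_zero) auto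
  \<comment> \<open>\<open>cos sigma_c = 1 / sqrt 10 = 0.31622...\<close>, which \<open>0.31625\<close> and \<open>0.316\<close> separate from the cosines of
    the two bounds.\<close>
  have "cos (1.249::real) > 0.31625"
    using cos_Maclaurin_12[of "1.249"] unfolding abs_le_iff by (simp add: power_divide)
  moreover have "cos sigma_c < 0.31625"
    by (rule power2_less_imp_less) (simp_all add: sigma_c_basic(3) power_divide)
  ultimately have "\<not> sigma_c < 1.249"
    using cos_monotone_0_pi[of sigma_c "1.249"] sigma_c_basic pi_gt3 by auto
  then show "1.249 \<le> sigma_c" by simp
  have "cos (1.250::real) < 0.316"
    using cos_Maclaurin_12[of "1.250"] unfolding abs_le_iff by (simp add: power_divide)
  moreover have "cos sigma_c > 0.316"
    by (rule power2_less_imp_less) (use c in \<open>simp_all add: sigma_c_basic(3) power_divide\<close>)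
  ultimately show "sigma_c < 1.250"
    using cos_monotone_0_pi_le[of "1.250" sigma_c] sigma_c_basic pi_gt3 by force
qed

section \<open>Preliminaries on curves\<close>

lemma U_phys_near_equilateral:
  assumes "0 < p" "p < 2 * pi / 3"
  obtains \<epsilon> where "\<epsilon> > 0" "\<And>s. (\<And>k. \<bar>s $ k - p\<bar> < \<epsilon>) \<Longrightarrow> s \<in> U_phys"
proof
  define \<epsilon> where "\<epsilon> = min (p / 3) (2 * pi / 3 - p)"
  have "\<epsilon> \<le> p / 3" "\<epsilon> \<le> 2 * pi / 3 - p" unfolding \<epsilon>_def by (rule min.cobounded1 min.cobounded2)+
  then have \<epsilon>: "3 * \<epsilon> \<le> p" "p + \<epsilon> \<le> 2 * pi / 3" by linarith+
  show "\<epsilon> > 0" using assms by (simp add: \<epsilon>_def)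
  fix s :: "real ^ 3" assume "\<And>k. \<bar>s $ k - p\<bar> < \<epsilon>"
  then have s: "p - \<epsilon> < s $ k" "s $ k < p + \<epsilon>" for k
    by (simp_all add: abs_diff_less_iff)
  have "0 < s $ k \<and> s $ k < pi" for k using s[of k] \<epsilon> assms pi_gt_zero by linarith
  moreover have "s $ k \<le> s $ i + s $ j" for i j k using s(2)[of k] s(1)[of i] s(1)[of j] \<epsilon> by linarith
  moreover have "s $ 1 + s $ 2 + s $ 3 \<le> 2 * pi" using s(2)[of 1] s(2)[of 2] s(2)[of 3] \<epsilon> by linarith
  ultimately show "s \<in> U_phys" by (auto simp: U_phys_def U_def)
qed

text \<open>
  A regular curve does not return to a point at arbitrarily near parameters: if \<open>f u = f t\<close>, the
  difference quotient is off from \<open>D\<close> by the full amount \<open>norm D\<close>.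
\<close>
lemma eventually_ne_of_vector_derivative:
  fixes f :: "real \<Rightarrow> 'a :: real_normed_vector"
  assumes "(f has_vector_derivative D) (at t)" "D \<noteq> 0"
  shows "eventually (\<lambda>u. f u \<noteq> f t) (at t)"
proof -
  have "((\<lambda>u. norm (f u - f t - (u - t) *\<^sub>R D) / norm (u - t)) \<longlongrightarrow> 0) (at t)"
    using assms(1) by (simp add: has_vector_derivative_def has_derivative_iff_norm)
  then have "eventually (\<lambda>u. norm (f u - f t - (u - t) *\<^sub>R D) / norm (u - t) < norm D) (at t)"
    using assms(2) by (intro order_tendstoD(2)) auto
  moreover have "eventually (\<lambda>u. u \<noteq> t) (at t)"
    by (simp add: eventually_at_filter)
  ultimately show ?thesis by eventually_elim auto
qed

lemma C1_differentiable_on_arccos: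
  assumes "f C1_differentiable_on S" "\<And>t. t \<in> S \<Longrightarrow> \<bar>f t\<bar> < 1"
  shows "(\<lambda>t. arccos (f t)) C1_differentiable_on S"
proof -
  obtain f' where f': "\<And>t. t \<in> S \<Longrightarrow> (f has_real_derivative f' t) (at t)" and c: "continuous_on S f'"
    using assms(1) by (auto simp: C1_differentiable_on_def has_real_derivative_iff_has_vector_derivative)
  have cf: "continuous_on S f"
    using f' by (meson DERIV_isCont continuous_at_imp_continuous_on)
  have ne: "sqrt (1 - (f t)\<^sup>2) \<noteq> 0" if "t \<in> S" for t
    using assms(2)[OF that] by (simp add: abs_square_eq_1 abs_less_iff) (metis abs_square_less_1 assms(2) less_irrefl that)
  have "((\<lambda>t. arccos (f t)) has_real_derivative inverse (- sqrt (1 - (f t)\<^sup>2)) * f' t) (at t)" if "t \<in> S" for t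
    using assms(2)[OF that] by (intro DERIV_chain2[OF DERIV_arccos f'] that) auto
  moreover have "continuous_on S (\<lambda>t. inverse (- sqrt (1 - (f t)\<^sup>2)) * f' t)"
    using ne by (intro continuous_intros cf c) auto
  ultimately show ?thesis
    unfolding C1_differentiable_on_def has_real_derivative_iff_has_vector_derivative
    by (intro exI[of _ "\<lambda>t. inverse (- sqrt (1 - (f t)\<^sup>2)) * f' t"]) simp
qed

section \<open>The isosceles family as a curve\<close>

lemma branch_denom_bounds:
  assumes "0 < r" "r ^ 6 < 4"
  shows "0 < branch_denom r" "r ^ 6 < branch_denom r" "(2 - r ^ 6)\<^sup>2 < branch_denom r"
proof -
  have pos: "(1 + r ^ 2 + r ^ 4) * (4 - r ^ 6) > 0"
    using assms by (intro mult_pos_pos add_pos_pos) auto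
  then show 1: "r ^ 6 < branch_denom r" using branch_denom_diff(1)[of r] by simp
  have "r\<^sup>2 * ((1 + r ^ 2 + r ^ 4) * (4 - r ^ 6)) > 0" using pos assms by simp
  then show "(2 - r ^ 6)\<^sup>2 < branch_denom r" using branch_denom_diff(2)[of r] by simp
  show "0 < branch_denom r" using 1 assms zero_less_power[of r 6] by linarith
qed

text \<open>
  The repeated and the odd angle of the isosceles \<open>LRE\<close> with ratio of sines \<open>r\<close>: the equation
  \<open>(cos x)\<^sup>2 = r ^ 6 / D r\<close> is solved for \<open>x\<close>, and the balance equation then gives \<open>cos y\<close>.  The sign
  \<open>e = \<plusminus>1\<close> of the square root distinguishes the two mirror branches \<open>(x, y)\<close> and
  \<open>(\<pi> - x, \<pi> - y)\<close>, one through each critical point.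
\<close>
definition equal_angle :: "real \<Rightarrow> real \<Rightarrow> real" where
  "equal_angle e r = arccos (e * (r ^ 3 * inverse (sqrt (branch_denom r))))"

definition odd_angle :: "real \<Rightarrow> real \<Rightarrow> real" where
  "odd_angle e r = arccos (e * ((2 - r ^ 6) * inverse (sqrt (branch_denom r))))"

lemma branch_cos_less_1:
  fixes e :: real
  assumes "0 < r" "r ^ 6 < 4" and e: "e\<^sup>2 = 1"
  shows "\<bar>e * (r ^ 3 * inverse (sqrt (branch_denom r)))\<bar> < 1"
    and "\<bar>e * ((2 - r ^ 6) * inverse (sqrt (branch_denom r)))\<bar> < 1"
proof -
  note b = branch_denom_bounds[OF assms(1,2)]
  have sq: "(e * (z * inverse (sqrt (branch_denom r))))\<^sup>2 = z\<^sup>2 / branch_denom r" for z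
    using b(1) e by (simp add: power_mult_distrib power_inverse divide_inverse)
  show "\<bar>e * (r ^ 3 * inverse (sqrt (branch_denom r)))\<bar> < 1"
    and "\<bar>e * ((2 - r ^ 6) * inverse (sqrt (branch_denom r)))\<bar> < 1"
    using b by (simp_all add: sq flip: abs_square_less_1 power_mult)
qed

lemma branch_balanced:
  fixes e :: real
  assumes r: "0 < r" "r ^ 6 < 4" and e: "e\<^sup>2 = 1"
  shows "balanced (equal_angle e r) (odd_angle e r)"
    and "sin (odd_angle e r) = r * sin (equal_angle e r)"
    and "sin (equal_angle e r) > 0"
proof -
  note b = branch_denom_bounds[OF r]
  note l = branch_cos_less_1[OF assms]
  define h where "h = inverse (sqrt (branch_denom r))"
  have h: "h\<^sup>2 * branch_denom r = 1" using b(1) by (simp add: h_def power_inverse)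
  have c: "cos (equal_angle e r) = e * (r ^ 3 * h)" "cos (odd_angle e r) = e * ((2 - r ^ 6) * h)"
    using l by (simp_all add: equal_angle_def odd_angle_def h_def abs_less_iff cos_arccos)
  have s: "sin (equal_angle e r) = sqrt (1 - (e * (r ^ 3 * h))\<^sup>2)"
    "sin (odd_angle e r) = sqrt (1 - (e * ((2 - r ^ 6) * h))\<^sup>2)"
    using l by (simp_all add: equal_angle_def odd_angle_def h_def abs_less_iff sin_arccos)
  show pos: "sin (equal_angle e r) > 0"
    unfolding s using l(1) by (simp add: h_def abs_square_less_1)
  have sq: "(e * (z * h))\<^sup>2 = h\<^sup>2 * z\<^sup>2" for z
    using e by (simp add: power_mult_distrib)
  have "1 - (e * ((2 - r ^ 6) * h))\<^sup>2 = r\<^sup>2 * (1 - (e * (r ^ 3 * h))\<^sup>2)"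
  proof -
    have "1 - (e * ((2 - r ^ 6) * h))\<^sup>2 = h\<^sup>2 * (branch_denom r - (2 - r ^ 6)\<^sup>2)"
      unfolding sq using h by (simp add: right_diff_distrib)
    also have "\<dots> = r\<^sup>2 * (h\<^sup>2 * (branch_denom r - r ^ 6))"
      unfolding branch_denom_diff by simp
    also have "h\<^sup>2 * (branch_denom r - r ^ 6) = 1 - (e * (r ^ 3 * h))\<^sup>2"
      unfolding sq using h by (simp add: right_diff_distrib)
    finally show ?thesis .
  qed
  then show ratio: "sin (odd_angle e r) = r * sin (equal_angle e r)"
    unfolding s using r by (simp add: real_sqrt_mult)
  then have "sin (odd_angle e r) / sin (equal_angle e r) = r" using pos by simp
  then show "balanced (equal_angle e r) (odd_angle e r)"
    by (simp add: balanced_def c)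
qed

text \<open>
  Any interval around \<open>r = 1\<close> with \<open>r > 0\<close> and \<open>r ^ 6 < 4\<close> serves as the parameter range.
\<close>
lemma branch_domain: "0 < r" "r ^ 6 < 4" if "r \<in> {1/2<..<6/5}" for r :: real
proof -
  show "0 < r" using that by simp
  then have "r ^ 6 < (6 / 5) ^ 6" using that by (intro power_strict_mono) auto
  then show "r ^ 6 < 4" by (simp add: power_divide)
qed

lemma DERIV_inverse_sqrt_branch_denom:
  assumes "branch_denom r > 0"
  shows "((\<lambda>r. inverse (sqrt (branch_denom r))) has_real_derivative
     - (4 * r + 8 * r ^ 3 - 4 * r ^ 7 - 5 * r ^ 9) * inverse (sqrt (branch_denom r)) ^ 3) (at r)"
proof -
  have D: "(branch_denom has_real_derivative 8 * r + 16 * r ^ 3 - 8 * r ^ 7 - 10 * r ^ 9) (at r)"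
    unfolding branch_denom_def[abs_def] by (auto intro!: derivative_eq_intros)
  have "sqrt (branch_denom r) \<noteq> 0" using assms by simp
  from DERIV_inverse'[OF DERIV_chain2[OF DERIV_real_sqrt[OF assms] D] this] show ?thesis
    by (rule DERIV_cong) (simp add: algebra_simps power3_eq_cube)
qed

lemma angles_C1:
  assumes e: "e\<^sup>2 = 1"
  shows "equal_angle e C1_differentiable_on {1/2<..<6/5}" "odd_angle e C1_differentiable_on {1/2<..<6/5}"
proof -
  let ?S = "{1/2<..<6/5 :: real}"
  have pos: "branch_denom r > 0" if "r \<in> ?S" for r
    using branch_denom_bounds(1) branch_domain[OF that] by blast
  have cont: "continuous_on ?S branch_denom"
    unfolding branch_denom_def[abs_def] by (intro continuous_intros)
  have h: "(\<lambda>r. inverse (sqrt (branch_denom r))) C1_differentiable_on ?S"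
    unfolding C1_differentiable_on_def
  proof (intro exI conjI ballI)
    show "((\<lambda>r. inverse (sqrt (branch_denom r))) has_vector_derivative
       - (4 * r + 8 * r ^ 3 - 4 * r ^ 7 - 5 * r ^ 9) * inverse (sqrt (branch_denom r)) ^ 3) (at r)"
      if "r \<in> ?S" for r
      using DERIV_inverse_sqrt_branch_denom[OF pos[OF that]]
      by (simp add: has_real_derivative_iff_has_vector_derivative)
    show "continuous_on ?S (\<lambda>r. - (4 * r + 8 * r ^ 3 - 4 * r ^ 7 - 5 * r ^ 9) * inverse (sqrt (branch_denom r)) ^ 3)"
      using pos by (intro continuous_intros cont) force
  qed
  have pow: "(\<lambda>r. r ^ n) C1_differentiable_on ?S" for n
    by (induction n) simp_all
  show "equal_angle e C1_differentiable_on ?S"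
    unfolding equal_angle_def[abs_def]
    by (intro C1_differentiable_on_arccos C1_differentiable_on_mult C1_differentiable_on_const h pow
      branch_cos_less_1 branch_domain e)
  show "odd_angle e C1_differentiable_on ?S"
    unfolding odd_angle_def[abs_def]
    by (intro C1_differentiable_on_arccos C1_differentiable_on_mult C1_differentiable_on_diff
      C1_differentiable_on_const h pow branch_cos_less_1 branch_domain e)
qed

text \<open>
  The derivative of \<open>r ^ 3 / sqrt (D r)\<close> is
  \<open>r\<^sup>2 * (12 + 8 r\<^sup>2 + 4 r ^ 4 + r ^ 8 + 2 r ^ 10) / sqrt (D r) ^ 3\<close>, whose coefficients are all
  positive.  Hence \<open>cos x\<close>, and with it \<open>x\<close>, has no critical point along the branch.
\<close>
lemma equal_angle_regular:
  assumes r: "0 < r" "r ^ 6 < 4" and e: "e\<^sup>2 = 1"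
  shows "\<not> (equal_angle e has_real_derivative 0) (at r)"
proof
  assume D0: "(equal_angle e has_real_derivative 0) (at r)"
  define h where "h = inverse (sqrt (branch_denom r))"
  note b = branch_denom_bounds[OF r]
  have h: "h > 0" "h\<^sup>2 * branch_denom r = 1" using b(1) by (simp_all add: h_def power_inverse)
  have "e \<noteq> 0" using e by auto
  have "open {r::real. 0 < r \<and> r ^ 6 < 4}"
    by (intro open_Collect_conj open_Collect_less continuous_intros)
  then have "eventually (\<lambda>t. 0 < t \<and> t ^ 6 < 4) (nhds r)"
    using r eventually_nhds_in_open[of "{r::real. 0 < r \<and> r ^ 6 < 4}" r] by simp
  then have ev: "eventually (\<lambda>t. cos (equal_angle e t) = e * (t ^ 3 * inverse (sqrt (branch_denom t)))) (nhds r)"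
  proof (rule eventually_mono)
    fix t :: real assume "0 < t \<and> t ^ 6 < 4"
    then show "cos (equal_angle e t) = e * (t ^ 3 * inverse (sqrt (branch_denom t)))"
      using branch_cos_less_1(1)[OF _ _ e, of t] by (simp add: equal_angle_def abs_less_iff cos_arccos)
  qed
  have "((\<lambda>t. cos (equal_angle e t)) has_real_derivative 0) (at r)"
    using DERIV_chain2[OF DERIV_cos D0] by simp
  then have "((\<lambda>t. e * (t ^ 3 * inverse (sqrt (branch_denom t)))) has_real_derivative 0) (at r)"
    using DERIV_cong_ev[OF refl ev refl] by simp
  moreover have "((\<lambda>t. e * (t ^ 3 * inverse (sqrt (branch_denom t)))) has_real_derivative
      e * (r ^ 3 * (- (4 * r + 8 * r ^ 3 - 4 * r ^ 7 - 5 * r ^ 9) * h ^ 3) + 3 * r\<^sup>2 * h)) (at r)"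
  proof -
    have "((\<lambda>t. t ^ 3) has_real_derivative 3 * r\<^sup>2) (at r)"
      by (auto intro!: derivative_eq_intros)
    from DERIV_cmult[OF DERIV_mult[OF this DERIV_inverse_sqrt_branch_denom[OF b(1)]], of e] show ?thesis
      unfolding h_def by (rule DERIV_cong) (simp add: algebra_simps)
  qed
  ultimately have "0 = e * (r ^ 3 * (- (4 * r + 8 * r ^ 3 - 4 * r ^ 7 - 5 * r ^ 9) * h ^ 3) + 3 * r\<^sup>2 * h)"
    by (rule DERIV_unique)
  moreover have "r ^ 3 * (- (4 * r + 8 * r ^ 3 - 4 * r ^ 7 - 5 * r ^ 9) * h ^ 3) + 3 * r\<^sup>2 * h
      = r\<^sup>2 * h ^ 3 * (12 + 8 * r ^ 2 + 4 * r ^ 4 + r ^ 8 + 2 * r ^ 10)"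
  proof -
    define P where "P = 4 * r + 8 * r ^ 3 - 4 * r ^ 7 - 5 * r ^ 9"
    have "3 * r\<^sup>2 * h = 3 * r\<^sup>2 * h * (h\<^sup>2 * branch_denom r)" using h(2) by simp
    then have "r ^ 3 * (- P * h ^ 3) + 3 * r\<^sup>2 * h = r ^ 3 * (- P * h ^ 3) + 3 * r\<^sup>2 * h * (h\<^sup>2 * branch_denom r)"
      by (rule arg_cong)
    also have "\<dots> = r\<^sup>2 * h ^ 3 * (3 * branch_denom r - r * P)"
      by (simp add: power3_eq_cube power2_eq_square right_diff_distrib)
    also have "3 * branch_denom r - r * P = 12 + 8 * r ^ 2 + 4 * r ^ 4 + r ^ 8 + 2 * r ^ 10"
      by (simp add: P_def branch_denom_def eval_nat_numeral algebra_simps)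
    finally show ?thesis unfolding P_def .
  qed
  moreover have "12 + 8 * r ^ 2 + 4 * r ^ 4 + r ^ 8 + 2 * r ^ 10 > 0"
    using r by (intro add_pos_pos mult_pos_pos zero_less_power) auto
  ultimately show False using r h \<open>e \<noteq> 0\<close> by simp
qed

section \<open>Bifurcation points\<close>

lemma equilateral_LRE_curve:
  fixes m :: "real ^ 3"
  assumes "m $ 1 = M" "m $ 2 = M" "m $ 3 = M"
  shows "LRE_continuation m vec 0 (2 * pi / 3)"
proof -
  have vec_eq: "(\<lambda>t::real. t *\<^sub>R (vec 1 :: real ^ 3)) = vec" by (auto simp: vec_eq_iff)
  have "((\<lambda>t. t *\<^sub>R vec 1) has_vector_derivative (vec 1 :: real ^ 3)) (at t)" for t :: real
    by (auto intro!: derivative_eq_intros)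
  then have der: "(vec has_vector_derivative (vec 1 :: real ^ 3)) (at t)" for t :: real
    unfolding vec_eq .
  have "vec t \<in> LRE m" if t: "0 < t" "t < 2 * pi / 3" for t
  proof -
    obtain \<epsilon> where "\<epsilon> > 0" "\<And>s. (\<And>k. \<bar>s $ k - t\<bar> < \<epsilon>) \<Longrightarrow> s \<in> U_phys"
      using U_phys_near_equilateral[OF t] by metis
    then have "vec t \<in> U_phys" by simp
    moreover from this have "vec t \<in> U" by (simp add: U_phys_def)
    ultimately show ?thesis
      using lam_equal_masses[OF assms(1-3)] by (simp add: LRE_def)
  qed
  moreover have "(vec :: real \<Rightarrow> real ^ 3) C1_differentiable_on {0<..<2 * pi / 3}"
    unfolding C1_differentiable_on_def using der by (intro exI[of _ "\<lambda>_. vec 1"] conjI ballI continuous_on_const)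
  moreover have "vector_derivative vec (at t) \<noteq> (0 :: real ^ 3)" for t :: real
    using vector_derivative_at[OF der] by (simp add: vec_eq_iff)
  ultimately show ?thesis by (auto simp: LRE_continuation_def)
qed

text \<open>
  The branch \<open>r \<mapsto> (x r, x r, y r)\<close> passes through \<open>p\<close> at \<open>r = 1\<close> when the sign \<open>e\<close> is that of
  \<open>cos p\<close>.  By continuity it stays in \<open>U_phys\<close> for \<open>r\<close> near \<open>1\<close>, and for \<open>r \<noteq> 1\<close> the two sines differ,
  so the shape is not equilateral.
\<close>
lemma isosceles_LRE_curve:
  fixes m :: "real ^ 3"
  assumes m: "m $ 1 = M" "m $ 2 = M" "m $ 3 = M" "M \<noteq> 0"
  assumes p: "0 < p" "p < pi" "(cos p)\<^sup>2 = 1 / 10"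
  obtains \<delta> c d where "LRE_continuation m \<delta> c d" "vec p \<in> \<delta> ` {c<..<d}"
    "\<forall>s \<in> \<delta> ` {c<..<d} - {vec p}. isosceles_nonequilateral s"
proof -
  define e where "e = sgn (cos p)"
  have "cos p \<noteq> 0" using p(3) by auto
  then have e: "e\<^sup>2 = 1" by (simp add: e_def sgn_if)
  have "\<bar>cos p\<bar> = inverse (sqrt 10)"
    using p(3) by (metis real_sqrt_abs real_sqrt_inverse inverse_eq_divide)
  then have "e * inverse (sqrt 10) = cos p" by (metis e_def mult.commute abs_mult_sgn)
  then have at1: "equal_angle e 1 = p" "odd_angle e 1 = p"
    using p by (simp_all add: equal_angle_def odd_angle_def branch_denom_def arccos_cos)
  define \<delta> where "\<delta> r = equal_angle e r *\<^sub>R (axis 1 1 + axis 2 1 :: real ^ 3) + odd_angle e r *\<^sub>R axis 3 1" for r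
  have \<delta>_nth: "\<delta> r $ 1 = equal_angle e r" "\<delta> r $ 2 = equal_angle e r" "\<delta> r $ 3 = odd_angle e r" for r
    by (simp_all add: \<delta>_def axis_def)
  have \<delta>1: "\<delta> 1 = vec p" by (simp add: vec_eq_iff forall_3 \<delta>_nth at1)
  have C1: "\<delta> C1_differentiable_on {1/2<..<6/5}"
    unfolding \<delta>_def[abs_def] using angles_C1[OF e] by simp
  then have deriv: "(\<delta> has_vector_derivative vector_derivative \<delta> (at r)) (at r)" if "r \<in> {1/2<..<6/5}" for r
    using that by (auto simp: C1_differentiable_on_eq vector_derivative_works)
  obtain \<epsilon> where \<epsilon>: "\<epsilon> > 0" "\<And>s. (\<And>k. \<bar>s $ k - p\<bar> < \<epsilon>) \<Longrightarrow> s \<in> U_phys"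
    using U_phys_near_equilateral p cos_square_tenth_imp_less by metis
  have "isCont \<delta> 1"
    using deriv[of 1] by (simp add: has_vector_derivative_continuous)
  then obtain d where d: "d > 0" "\<And>r. dist r 1 < d \<Longrightarrow> dist (\<delta> r) (\<delta> 1) < \<epsilon>"
    unfolding continuous_at_eps_delta using \<epsilon>(1) by blast
  define d' where "d' = min d (1 / 10)"
  have d': "0 < d'" "d' \<le> d" "d' \<le> 1 / 10" using d(1) by (auto simp: d'_def)
  have dom: "r \<in> {1/2<..<6/5}" if "r \<in> {1 - d'<..<1 + d'}" for r
    using that d' by auto
  note dom' = branch_domain[OF dom]
  have phys: "\<delta> r \<in> U_phys" if "r \<in> {1 - d'<..<1 + d'}" for r
  proof (rule \<epsilon>(2))
    fix k
    have "dist (\<delta> r) (\<delta> 1) < \<epsilon>" using that d' by (intro d(2)) (auto simp: dist_real_def)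
    moreover have "\<bar>\<delta> r $ k - p\<bar> \<le> dist (\<delta> r) (\<delta> 1)"
      using dist_vec_nth_le[of "\<delta> r" k "\<delta> 1"] by (simp add: \<delta>1 dist_real_def)
    ultimately show "\<bar>\<delta> r $ k - p\<bar> < \<epsilon>" by linarith
  qed
  have LRE: "\<delta> r \<in> LRE m" if r: "r \<in> {1 - d'<..<1 + d'}" for r
  proof -
    have "\<delta> r \<in> U" using phys[OF r] by (simp add: U_phys_def)
    from lam_isosceles_iff_balanced(1)[OF m this] show ?thesis
      using phys[OF r] branch_balanced(1)[OF dom'[OF r] e] by (simp add: LRE_def \<delta>_nth)
  qed
  have reg: "vector_derivative \<delta> (at r) \<noteq> 0" if r: "r \<in> {1 - d'<..<1 + d'}" for r
  proof
    assume "vector_derivative \<delta> (at r) = 0"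
    then have "(\<delta> has_vector_derivative 0) (at r)" using deriv[OF dom[OF r]] by simp
    from bounded_linear.has_vector_derivative[OF bounded_linear_vec_nth this, of 1]
    have "(equal_angle e has_real_derivative 0) (at r)"
      by (simp add: \<delta>_nth has_real_derivative_iff_has_vector_derivative)
    then show False using equal_angle_regular[OF dom'[OF r] e] by simp
  qed
  have iso: "isosceles_nonequilateral (\<delta> r)" if r: "r \<in> {1 - d'<..<1 + d'}" and "r \<noteq> 1" for r
  proof -
    have "equal_angle e r \<noteq> odd_angle e r"
      using branch_balanced(2,3)[OF dom'[OF r] e] \<open>r \<noteq> 1\<close> by auto
    then show ?thesis by (simp add: isosceles_nonequilateral_def equilateral_def \<delta>_nth)
  qed
  show ?thesis
  proof
    show "LRE_continuation m \<delta> (1 - d') (1 + d')"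
      unfolding LRE_continuation_def
    proof (intro conjI ballI)
      show "\<delta> C1_differentiable_on {1 - d'<..<1 + d'}"
        using dom by (intro C1_differentiable_on_subset[OF C1] subsetI)
      show "\<delta> ` {1 - d'<..<1 + d'} \<subseteq> LRE m" using LRE by (rule image_subsetI)
    qed (use d' reg in \<open>simp_all\<close>)
    show "vec p \<in> \<delta> ` {1 - d'<..<1 + d'}" using \<delta>1 d' by (intro image_eqI[of _ _ 1]) auto
    show "\<forall>s\<in>\<delta> ` {1 - d'<..<1 + d'} - {vec p}. isosceles_nonequilateral s"
    proof (intro ballI, elim DiffE imageE)
      fix s r assume "s = \<delta> r" "r \<in> {1 - d'<..<1 + d'}" "s \<notin> {vec p}"
      then show "isosceles_nonequilateral s" using iso[of r] \<delta>1 by (cases "r = 1") simp_all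
    qed
  qed
qed

text \<open>
  The function \<open>K u v\<close> below vanishes at the repeated and the odd angle of every non-equilateral
  isosceles \<open>LRE\<close>, and such shapes occur on the curve \<open>\<delta>\<close> arbitrarily close to \<open>p\<close>.  By continuity it
  vanishes at the equilateral point itself, where it equals \<open>10 (cos x)\<^sup>2 - 1\<close>.
\<close>
lemma bifurcation_point_imp_cos:
  fixes m :: "real ^ 3"
  assumes m: "m $ 1 = M" "m $ 2 = M" "m $ 3 = M" "M \<noteq> 0"
  assumes "equilateral_isosceles_bifurcation_point m p"
  obtains x where "p = vec x" "0 < x" "x < pi" "(cos x)\<^sup>2 = 1 / 10"
proof -
  note bif = assms(5)[unfolded equilateral_isosceles_bifurcation_point_def]
  have phys: "p \<in> U_phys" by (rule conjunct1[OF bif])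
  from bif have eq: "equilateral p" by (elim conjE exE) (rule bspec)
  from bif obtain \<delta> c d where \<delta>: "LRE_continuation m \<delta> c d" "p \<in> \<delta> ` {c<..<d}"
    and iso: "\<forall>s \<in> \<delta> ` {c<..<d} - {p}. isosceles_nonequilateral s"
    by (elim conjE exE)
  define x where "x = p $ 1"
  have px: "p = vec x" using eq by (simp add: equilateral_def x_def vec_eq_iff forall_3)
  have x: "0 < x" "x < pi" using phys by (auto simp: U_phys_def U_def x_def)
  then have sx: "sin x > 0" by (rule sin_gt_zero)
  obtain t where t: "t \<in> {c<..<d}" "\<delta> t = p" using \<delta>(2) by blast
  have der: "(\<delta> has_vector_derivative vector_derivative \<delta> (at t)) (at t)" "vector_derivative \<delta> (at t) \<noteq> 0"
    using \<delta>(1) t(1) by (auto simp: LRE_continuation_def C1_differentiable_on_eq vector_derivative_works)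
  define K where "K u v = (cos u)\<^sup>2 * branch_denom (sin v / sin u) - (sin v / sin u) ^ 6" for u v
  have Kx: "K x x = 10 * (cos x)\<^sup>2 - 1" using sx by (simp add: K_def branch_denom_def)
  have "K x x = 0"
  proof (rule ccontr)
    assume ne: "K x x \<noteq> 0"
    \<comment> \<open>Which two of the angles agree may change along \<open>\<delta>\<close>, so the limit is taken for all pairs of
      indices at once.\<close>
    have lim: "((\<lambda>u. \<delta> u $ i) \<longlongrightarrow> x) (at t)" for i
      using has_vector_derivative_continuous[OF der(1)] t(2)
      by (auto simp: isCont_def px dest!: tendsto_vec_nth[of _ _ _ i])
    have "((\<lambda>u. K (\<delta> u $ i) (\<delta> u $ k)) \<longlongrightarrow> K x x) (at t)" for i k
      unfolding K_def branch_denom_def using sx by (intro tendsto_intros lim) auto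
    then have "eventually (\<lambda>u. K (\<delta> u $ i) (\<delta> u $ k) \<noteq> 0) (at t)" for i k
      using ne tendsto_imp_eventually_ne by blast
    then have "eventually (\<lambda>u. \<forall>i k. K (\<delta> u $ i) (\<delta> u $ k) \<noteq> 0) (at t)"
      by (intro eventually_all_finite)
    moreover have "eventually (\<lambda>u. \<delta> u \<noteq> p) (at t)"
      using eventually_ne_of_vector_derivative[OF der] t(2) by simp
    moreover have "eventually (\<lambda>u. u \<in> {c<..<d}) (at t)"
      using t(1) by (intro eventually_at_in_open') auto
    ultimately have "eventually (\<lambda>u. (\<forall>i k. K (\<delta> u $ i) (\<delta> u $ k) \<noteq> 0) \<and> \<delta> u \<noteq> p \<and> u \<in> {c<..<d}) (at t)"
      by (intro eventually_conj)
    then have "\<exists>u. (\<forall>i k. K (\<delta> u $ i) (\<delta> u $ k) \<noteq> 0) \<and> \<delta> u \<noteq> p \<and> u \<in> {c<..<d}"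
      by (rule eventually_happens'[OF trivial_limit_at])
    then obtain u where u: "\<And>i k. K (\<delta> u $ i) (\<delta> u $ k) \<noteq> 0" "\<delta> u \<noteq> p" "u \<in> {c<..<d}"
      by blast
    have L: "\<delta> u \<in> LRE m" using \<delta>(1) u(3) by (auto simp: LRE_continuation_def)
    have "isosceles_nonequilateral (\<delta> u)" using iso u by blast
    then obtain i k where ik: "\<delta> u $ i \<noteq> \<delta> u $ k" "balanced (\<delta> u $ i) (\<delta> u $ k)"
      using isosceles_LRE_imp_balanced[OF m L] by blast
    have "K (\<delta> u $ i) (\<delta> u $ k) = 0"
      using balanced_imp_cos_square[OF _ _ _ _ ik] L by (simp add: K_def LRE_def U_phys_def U_def)
    then show False using u(1) by blast
  qed
  then have "(cos x)\<^sup>2 = 1 / 10" using Kx by simp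
  then show ?thesis using that px x by blast
qed

theorem proposition2:
  fixes m :: "real ^ 3"
  assumes "m $ 1 = m $ 2" and "m $ 2 = m $ 3" and "m $ 1 > 0"
  shows "{p. equilateral_isosceles_bifurcation_point m p} = {vec sigma_c, vec (pi - sigma_c)}
    \<and> sigma_c \<noteq> pi - sigma_c
    \<and> 1.249 \<le> sigma_c \<and> sigma_c < 1.250"
proof -
  have m: "m $ 1 = m $ 1" "m $ 2 = m $ 1" "m $ 3 = m $ 1" "m $ 1 \<noteq> 0" using assms by auto
  have "equilateral_isosceles_bifurcation_point m p \<longleftrightarrow> p = vec sigma_c \<or> p = vec (pi - sigma_c)" for p
  proof
    assume "equilateral_isosceles_bifurcation_point m p"
    then show "p = vec sigma_c \<or> p = vec (pi - sigma_c)"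
      using bifurcation_point_imp_cos[OF m] cos_square_tenth_iff by metis
  next
    assume "p = vec sigma_c \<or> p = vec (pi - sigma_c)"
    then obtain x where x: "p = vec x" and x_eq: "x = sigma_c \<or> x = pi - sigma_c" by blast
    then have x_bounds: "0 < x" "x < pi" using sigma_c_basic by auto
    then have cos_x: "(cos x)\<^sup>2 = 1 / 10" using x_eq cos_square_tenth_iff by blast
    have x3: "x < 2 * pi / 3" using cos_square_tenth_imp_less x_bounds cos_x by blast
    obtain \<delta> c d where \<delta>: "LRE_continuation m \<delta> c d" "vec x \<in> \<delta> ` {c<..<d}"
      "\<forall>s \<in> \<delta> ` {c<..<d} - {vec x}. isosceles_nonequilateral s"
      by (rule isosceles_LRE_curve[OF m x_bounds cos_x])
    have \<gamma>: "LRE_continuation m vec 0 (2 * pi / 3)" by (rule equilateral_LRE_curve[OF m(1-3)])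
    have x_mem: "vec x \<in> vec ` {0<..<2 * pi / 3}" using x_bounds x3 by simp
    have "vec x \<in> U_phys" using \<gamma> x_mem by (auto simp: LRE_continuation_def LRE_def)
    then show "equilateral_isosceles_bifurcation_point m p"
      unfolding equilateral_isosceles_bifurcation_point_def x
    proof (intro conjI)
      show "\<exists>\<gamma> a b. LRE_continuation m \<gamma> a b \<and> vec x \<in> \<gamma> ` {a<..<b} \<and> (\<forall>s \<in> \<gamma> ` {a<..<b}. equilateral s)"
        using \<gamma> x_mem by (intro exI conjI) (auto simp: equilateral_def)
      show "\<exists>\<delta> c d. LRE_continuation m \<delta> c d \<and> vec x \<in> \<delta> ` {c<..<d}
          \<and> (\<forall>s \<in> \<delta> ` {c<..<d} - {vec x}. isosceles_nonequilateral s)"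
        using \<delta> by (intro exI conjI)
    qed
  qed
  then show ?thesis using sigma_c_numeric sigma_c_basic by auto
qed

end
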